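(* For every integer $n\ge 1$, $$\frac{1}{n}\sum_{m=0}^{n-1}\frac{1}{\binom{n-1}{m}}=H_n-\sum_{k=1}^{n-1}\frac{H_{n-k}}{2^k}.$$
   Context: $H_n=1+\frac12+\dots+\frac1n$ is the $n$-th harmonic number. An empty sum is $0$. *)

theory Defs
  imports "HOL-Analysis.Harmonic_Numbers"
begin

end

theory Submission
  imports Defs
begin

text \<open>
  Both sides satisfy the recurrence \<open>f (n + 1) = f n / 2 + 1 / (n + 1)\<close> with \<open>f 1 = 1\<close>.

  On the left this comes from a Pascal-type rule for reciprocals of binomial coefficients
  (\<open>inverse_binomial_pascal\<close>): two neighbours in row \<open>N + 1\<close> add up to a constant multiple of the
  entry of row \<open>N\<close> above them.  Summing along the row counts every entry of row \<open>N + 1\<close> twice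
  except the two outer ones, which equal 1; this gives \<open>sum_inverse_binomial_Suc\<close>.

  On the right, shifting the summation index shows that the sum of the \<open>harm (n - k) / 2 ^ k\<close>
  at \<open>n + 1\<close> is half of \<open>harm n\<close> plus half of the sum at \<open>n\<close> (\<open>sum_halving_Suc\<close>); subtracting
  this from \<open>harm (n + 1) = harm n + 1 / (n + 1)\<close> halves the right-hand side and adds
  \<open>1 / (n + 1)\<close>.
\<close>

text \<open>
  By absorption, both binomial coefficients of row \<open>N + 1\<close> are rational multiples of \<open>N choose m\<close>:
  their reciprocals are \<open>(N + 1 - m) / ((N + 1) * (N choose m))\<close> and
  \<open>(m + 1) / ((N + 1) * (N choose m))\<close>, and in the sum the numerators lose their dependence on \<open>m\<close>.
\<close>

lemma inverse_binomial_pascal: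
  assumes "m \<le> N"
  shows "1 / real (Suc N choose m) + 1 / real (Suc N choose Suc m)
       = (real N + 2) / (real N + 1) * (1 / real (N choose m))"
proof -
  define x y z where "x = real (N choose m)" and "y = real (Suc N choose m)"
    and "z = real (Suc N choose Suc m)"
  have pos: "x > 0" "y > 0" "z > 0"
    using assms by (simp_all add: x_def y_def z_def del: binomial_Suc_Suc)
  have "real (Suc N - m) * y = real (Suc N) * x"
    unfolding x_def y_def using binomial_absorb_comp[of "Suc N" m]
    by (metis diff_Suc_1 of_nat_mult)
  moreover have "real (Suc N - m) = real N + 1 - real m"
    using assms by simp
  ultimately have "(real N + 1 - real m) * y = (real N + 1) * x"
    by (simp add: algebra_simps)
  then have left: "1 / y = (real N + 1 - real m) / ((real N + 1) * x)"
    using pos by (subst frac_eq_eq) auto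
  have "real (Suc m) * z = real (Suc N) * x"
    unfolding x_def z_def by (metis Suc_times_binomial of_nat_mult)
  then have "(real m + 1) * z = (real N + 1) * x"
    by (simp add: algebra_simps)
  then have right: "1 / z = (real m + 1) / ((real N + 1) * x)"
    using pos by (subst frac_eq_eq) auto
  have "1 / y + 1 / z = (real N + 2) / (real N + 1) * (1 / x)"
    unfolding left right by (simp add: add_divide_distrib [symmetric])
  then show ?thesis
    by (simp only: x_def y_def z_def)
qed

lemma sum_inverse_binomial_Suc:
  "(\<Sum>m = 0..Suc N. 1 / real (Suc N choose m))
   = (real N + 2) / (2 * (real N + 1)) * (\<Sum>m = 0..N. 1 / real (N choose m)) + 1"
proof -
  let ?r = "\<lambda>m. 1 / real (Suc N choose m)"
  let ?S = "\<Sum>m = 0..Suc N. ?r m"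
  have "(real N + 2) / (real N + 1) * (\<Sum>m = 0..N. 1 / real (N choose m))
      = (\<Sum>m = 0..N. ?r m + ?r (Suc m))"
    unfolding sum_distrib_left
    by (intro sum.cong refl inverse_binomial_pascal [symmetric]) simp
  also have "\<dots> = (\<Sum>m = 0..N. ?r m) + (\<Sum>m = 0..N. ?r (Suc m))"
    by (rule sum.distrib)
  also have "(\<Sum>m = 0..N. ?r m) = ?S - 1"
    by (simp del: binomial_Suc_Suc)
  also have "(\<Sum>m = 0..N. ?r (Suc m)) = ?S - 1"
    by (subst sum.atLeast0_atMost_Suc_shift) (simp del: binomial_Suc_Suc)
  finally show ?thesis
    by (simp add: field_simps del: binomial_Suc_Suc sum.cl_ivl_Suc)
qed

lemma sum_halving_Suc:
  fixes a :: "nat \<Rightarrow> real"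
  assumes "n \<ge> 1"
  shows "(\<Sum>k = 1..n. a (Suc n - k) / 2 ^ k)
       = a n / 2 + (\<Sum>k = 1..n - 1. a (n - k) / 2 ^ k) / 2"
proof -
  obtain N where n: "n = Suc N"
    using assms by (cases n) auto
  have "(\<Sum>k = 1..n. a (Suc n - k) / 2 ^ k)
      = a n / 2 + (\<Sum>k = Suc 1..Suc N. a (Suc n - k) / 2 ^ k)"
    unfolding n by (subst sum.atLeast_Suc_atMost) simp_all
  also have "(\<Sum>k = Suc 1..Suc N. a (Suc n - k) / 2 ^ k) = (\<Sum>k = 1..N. a (n - k) / 2 ^ k / 2)"
    by (subst sum.shift_bounds_cl_Suc_ivl) (simp add: mult.commute)
  finally show ?thesis
    by (simp add: n sum_divide_distrib)
qed

theorem theorem6p1: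
  fixes n :: nat
  assumes "n \<ge> 1"
  shows "1 / real n * (\<Sum>m = 0..n - 1. 1 / real ((n - 1) choose m))
       = (harm n :: real) - (\<Sum>k = 1..n - 1. harm (n - k) / 2 ^ k)"
  using assms
proof (induction n rule: dec_induct)
  case base
  then show ?case
    by (simp add: harm_def)
next
  case (step n)
  let ?S = "\<lambda>N. \<Sum>m = 0..N. 1 / real (N choose m)"
  let ?T = "\<lambda>n. \<Sum>k = 1..n - 1. (harm (n - k) :: real) / 2 ^ k"
  obtain N where n: "n = Suc N"
    using step.hyps by (cases n) auto
  have N: "real N + 1 = real n" "real N + 2 = real n + 1"
    by (simp_all add: n)
  have S: "?S n = (real n + 1) / (2 * real n) * ?S (n - 1) + 1"
    using sum_inverse_binomial_Suc[of N, folded n] unfolding N by (simp only: n diff_Suc_1)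
  have "1 / real (Suc n) * ?S n = (1 / real n * ?S (n - 1)) / 2 + 1 / real (Suc n)"
  proof -
    have "1 / (x + 1) * ((x + 1) / (2 * x) * s + 1) = (1 / x * s) / 2 + 1 / (x + 1)"
      if "x > 0" for x s :: real
      using that by (simp add: field_simps)
    from this[of "real n" "?S (n - 1)"] show ?thesis
      unfolding S using step.hyps by (simp only: of_nat_Suc add.commute[of 1 "real n"])
  qed
  also have "\<dots> = (harm n - ?T n) / 2 + 1 / real (Suc n)"
    by (simp only: step.IH)
  also have "\<dots> = harm (Suc n) - (harm n / 2 + ?T n / 2)"
    by (simp add: harm_Suc field_simps)
  also have "harm n / 2 + ?T n / 2 = ?T (Suc n)"
    using sum_halving_Suc[OF step.hyps(1), of harm] by simp
  finally show ?case
    by (simp only: diff_Suc_1)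
qed

end
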